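(* The subgroup identification problem is uniformly solvable in the class of finitely presented locally Hopfian groups. Hence, in this class of groups, weak effective coherence is equivalent to strong effective coherence: a finitely presented locally Hopfian group is weakly effectively coherent if and only if it is strongly effectively coherent.
   Context: Notation: for a group presentation $P=\langle X\mid R\rangle$, $\overline{P}$ denotes the group presented by $P$. $X^{*}$ denotes the set of finite words on $X\cup X^{-1}$, including the empty word. For a finite set of words $S=\{w_1,\dots,w_n\}\subset X^{*}$ and $G=\overline{P}$, $\langle S\rangle^{G}=\langle w_1,\dots,w_n\rangle^{\overline{P}}$ denotes the subgroup of $G$ generated by the elements these words represent. A partial algorithm is one that is not required to halt on all inputs. A group $G$ is Hopfian if every surjective endomorphism of $G$ is an isomorphism, and locally Hopfian if every finitely generated subgroup of $G$ is Hopfian. Subgroup identification problem: for a finite presentation $P=\langle X\mid R\rangle$ it is solvable if there is a partial algorithm that, on input of any finite set of words $w_1,\dots,w_n\in X^{*}$ and any finite presentation $Q=\langle Y\mid S\rangle$, outputs (if $\langle w_1,\dots,w_n\rangle^{\overline{P}}\cong\overline{Q}$) an explicit set map $\phi:Y\to\{w_1,\dots,w_n\}^{*}$ which extends to an isomorphism $\overline{\phi}:\overline{Q}\to\langle w_1,\dots,w_n\rangle^{\overline{P}}$; if $\langle w_1,\dots,w_n\rangle^{\overline{P}}\not\cong\overline{Q}$, no conditions are placed on the output or on halting. It is uniformly solvable in a class of finitely presented groups if there is a single partial algorithm, taking as additional input a finite presentation $P$ of a group in the class, that does this for every such $P$. A finitely generated group is coherent if all of its finitely generated subgroups are finitely presentable.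 A coherent group $G=\overline{\langle X\mid R\rangle}$ is weakly effectively coherent if there is an algorithm for $G$ that, on input of a finite collection of words $S\subset X^{*}$, outputs a finite presentation for the subgroup $\langle S\rangle^{G}$. A coherent group $G=\overline{\langle X\mid R\rangle}$ is strongly effectively coherent if there is an algorithm for $G$ that, on input of a finite collection of words $S\subset X^{*}$, outputs a finite presentation $P=\langle Y\mid V\rangle$ for the subgroup $\langle S\rangle^{G}$, along with a map $\phi:Y\to X^{*}$ which extends to an injection $\overline{\phi}:\overline{P}\to G$ whose image is $\langle S\rangle^{G}$. *)

theory Defs
  imports "HOL-Algebra.Generated_Groups" "HOL-Library.Nat_Bijection"
begin

section \<open>Groups given by presentations\<close>

text \<open>
  The letter \<open>(x, True)\<close> stands for the generator \<open>x\<close> and \<open>(x, False)\<close> for its formal inverse;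
  words need not be freely reduced.
\<close>

type_synonym 'a word = "('a \<times> bool) list"

definition words :: "'a set \<Rightarrow> 'a word set" where
  "words X = lists (X \<times> UNIV)"

definition inv_word :: "'a word \<Rightarrow> 'a word" where
  "inv_word w = rev (map (\<lambda>(x, b). (x, \<not> b)) w)"

text \<open>
  Two words are equivalent iff one is obtained from the other by finitely many insertions and
  deletions of relators and of the trivial relators \<open>x x\<^sup>-\<^sup>1\<close>, \<open>x\<^sup>-\<^sup>1 x\<close>.
\<close>

inductive word_eq :: "'a set \<Rightarrow> 'a word set \<Rightarrow> 'a word \<Rightarrow> 'a word \<Rightarrow> bool"
  for X :: "'a set" and R :: "'a word set" where
  refl: "u \<in> words X \<Longrightarrow> word_eq X R u u"
| sym: "word_eq X R u v \<Longrightarrow> word_eq X R v u"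
| trans: "word_eq X R u v \<Longrightarrow> word_eq X R v w \<Longrightarrow> word_eq X R u w"
| cancel: "u \<in> words X \<Longrightarrow> v \<in> words X \<Longrightarrow> x \<in> X \<Longrightarrow>
    word_eq X R (u @ [(x, b), (x, \<not> b)] @ v) (u @ v)"
| relator: "u \<in> words X \<Longrightarrow> v \<in> words X \<Longrightarrow> r \<in> R \<Longrightarrow> r \<in> words X \<Longrightarrow>
    word_eq X R (u @ r @ v) (u @ v)"

definition word_class :: "'a set \<Rightarrow> 'a word set \<Rightarrow> 'a word \<Rightarrow> 'a word set" where
  "word_class X R w = {v. word_eq X R w v}"

definition presented_group :: "'a set \<Rightarrow> 'a word set \<Rightarrow> 'a word set monoid" where
  "presented_group X R =
    \<lparr> carrier = word_class X R ` words X,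
      monoid.mult = (\<lambda>A B. {w. \<exists>u\<in>A. \<exists>v\<in>B. word_eq X R (u @ v) w}),
      one = word_class X R [] \<rparr>"

text \<open>
  To be usable as input and output of algorithms, a finite presentation has generators
  \<open>0, \<dots>, n - 1\<close> and a list of relators.
\<close>

type_synonym fin_pres = "nat \<times> nat word list"

definition valid_pres :: "fin_pres \<Rightarrow> bool" where
  "valid_pres P \<longleftrightarrow> set (snd P) \<subseteq> words {..<fst P}"

definition grp :: "fin_pres \<Rightarrow> nat word set monoid" where
  "grp P = presented_group {..<fst P} (set (snd P))"

definition elt :: "fin_pres \<Rightarrow> nat word \<Rightarrow> nat word set" where
  "elt P w = word_class {..<fst P} (set (snd P)) w"

definition sub_grp :: "fin_pres \<Rightarrow> nat word list \<Rightarrow> nat word set monoid" where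
  "sub_grp P ws = subgroup_generated (grp P) (elt P ` set ws)"

text \<open>
  The elements of \<open>{w\<^sub>0, \<dots>, w\<^sub>k\<^sub>-\<^sub>1}\<^sup>*\<close> are written as words over the index set \<open>{0, \<dots>, k - 1}\<close>; this
  function substitutes the \<open>w\<^sub>i\<close> for the indices.
\<close>

definition subst_word :: "'a word list \<Rightarrow> nat word \<Rightarrow> 'a word" where
  "subst_word ws u = concat (map (\<lambda>(i, b). if b then ws ! i else inv_word (ws ! i)) u)"


section \<open>Partial recursive functions\<close>

text \<open>
  Unary presentation of the partial recursive functions: several arguments are packed by the
  pairing bijection \<open>prod_encode\<close>.  In \<open>prec\<close>, \<open>f\<close> gives the initial value and \<open>g\<close> the
  recursion step, which receives the parameter, the recursion index and the previous value.
\<close>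

inductive partrec :: "(nat \<Rightarrow> nat option) \<Rightarrow> bool" where
  zero: "partrec (\<lambda>_. Some 0)"
| succ: "partrec (\<lambda>n. Some (Suc n))"
| fst: "partrec (\<lambda>n. Some (fst (prod_decode n)))"
| snd: "partrec (\<lambda>n. Some (snd (prod_decode n)))"
| pair: "partrec f \<Longrightarrow> partrec g \<Longrightarrow>
    partrec (\<lambda>n. Option.bind (f n) (\<lambda>x. Option.bind (g n) (\<lambda>y. Some (prod_encode (x, y)))))"
| comp: "partrec f \<Longrightarrow> partrec g \<Longrightarrow> partrec (\<lambda>n. Option.bind (g n) f)"
| prec: "partrec f \<Longrightarrow> partrec g \<Longrightarrow>
    partrec (\<lambda>n. case prod_decode n of (a, k) \<Rightarrow>
      rec_nat (f a) (\<lambda>m r. Option.bind r (\<lambda>i. g (prod_encode (a, prod_encode (m, i))))) k)"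
| mu: "partrec f \<Longrightarrow>
    partrec (\<lambda>a.
      if \<exists>n. f (prod_encode (a, n)) = Some 0 \<and>
             (\<forall>m<n. \<exists>k. f (prod_encode (a, m)) = Some (Suc k))
      then Some (LEAST n. f (prod_encode (a, n)) = Some 0)
      else None)"

definition encode_word :: "nat word \<Rightarrow> nat" where
  "encode_word w = list_encode (map (\<lambda>(x, b). prod_encode (x, of_bool b)) w)"

definition encode_words :: "nat word list \<Rightarrow> nat" where
  "encode_words ws = list_encode (map encode_word ws)"

definition encode_pres :: "fin_pres \<Rightarrow> nat" where
  "encode_pres P = prod_encode (fst P, encode_words (snd P))"


section \<open>Hopfian and coherent groups\<close>

definition hopfian :: "('a, 'b) monoid_scheme \<Rightarrow> bool" where
  "hopfian G \<longleftrightarrow> (\<forall>h \<in> epi G G. h \<in> iso G G)"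

definition locally_hopfian :: "('a, 'b) monoid_scheme \<Rightarrow> bool" where
  "locally_hopfian G \<longleftrightarrow>
    (\<forall>A. finite A \<and> A \<subseteq> carrier G \<longrightarrow> hopfian (subgroup_generated G A))"

definition finitely_generated :: "('a, 'b) monoid_scheme \<Rightarrow> bool" where
  "finitely_generated G \<longleftrightarrow> (\<exists>A. finite A \<and> A \<subseteq> carrier G \<and> generate G A = carrier G)"

definition finitely_presentable :: "('a, 'b) monoid_scheme \<Rightarrow> bool" where
  "finitely_presentable G \<longleftrightarrow> (\<exists>P. valid_pres P \<and> grp P \<cong> G)"

definition coherent :: "('a, 'b) monoid_scheme \<Rightarrow> bool" where
  "coherent G \<longleftrightarrow> finitely_generated G \<and>
    (\<forall>A. finite A \<and> A \<subseteq> carrier G \<longrightarrow> finitely_presentable (subgroup_generated G A))"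


section \<open>Algorithmic problems\<close>

text \<open>
  A map \<open>\<phi>\<close> defined on the generators \<open>{0, \<dots>, m - 1}\<close> of \<open>Q\<close> is given by the list of its
  values.  A class of finitely presented groups is given by a predicate \<open>C\<close> on groups; the input
  \<open>P\<close> ranges over all finite presentations of groups in the class.
\<close>

definition identifies_subgroup ::
    "fin_pres \<Rightarrow> nat word list \<Rightarrow> fin_pres \<Rightarrow> nat word list \<Rightarrow> bool" where
  "identifies_subgroup P ws Q \<phi> \<longleftrightarrow>
    length \<phi> = fst Q \<and> set \<phi> \<subseteq> words {..<length ws} \<and>
    (\<exists>h \<in> iso (grp Q) (sub_grp P ws).
      \<forall>y < fst Q. h (elt Q [(y, True)]) = elt P (subst_word ws (\<phi> ! y)))"

definition subgroup_identification_uniformly_solvable ::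
    "(nat word set monoid \<Rightarrow> bool) \<Rightarrow> bool" where
  "subgroup_identification_uniformly_solvable C \<longleftrightarrow>
    (\<exists>f. partrec f \<and>
      (\<forall>P ws Q. valid_pres P \<and> C (grp P) \<and> set ws \<subseteq> words {..<fst P} \<and> valid_pres Q \<and>
          sub_grp P ws \<cong> grp Q \<longrightarrow>
        (\<exists>\<phi>. f (prod_encode (encode_pres P, prod_encode (encode_words ws, encode_pres Q)))
               = Some (encode_words \<phi>) \<and>
             identifies_subgroup P ws Q \<phi>)))"

definition weakly_effectively_coherent :: "fin_pres \<Rightarrow> bool" where
  "weakly_effectively_coherent P \<longleftrightarrow> coherent (grp P) \<and>
    (\<exists>f. partrec f \<and>
      (\<forall>ws. set ws \<subseteq> words {..<fst P} \<longrightarrow>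
        (\<exists>Q. f (encode_words ws) = Some (encode_pres Q) \<and>
             valid_pres Q \<and> grp Q \<cong> sub_grp P ws)))"

definition strongly_effectively_coherent :: "fin_pres \<Rightarrow> bool" where
  "strongly_effectively_coherent P \<longleftrightarrow> coherent (grp P) \<and>
    (\<exists>f. partrec f \<and>
      (\<forall>ws. set ws \<subseteq> words {..<fst P} \<longrightarrow>
        (\<exists>Q \<phi>. f (encode_words ws) = Some (prod_encode (encode_pres Q, encode_words \<phi>)) \<and>
             valid_pres Q \<and> length \<phi> = fst Q \<and> set \<phi> \<subseteq> words {..<fst P} \<and>
             (\<exists>h \<in> mon (grp Q) (grp P).
               (\<forall>y < fst Q. h (elt Q [(y, True)]) = elt P (\<phi> ! y)) \<and>
               h ` carrier (grp Q) = carrier (sub_grp P ws)))))"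


section \<open>Presented groups are groups\<close>

lemma words_append [simp]: "u @ v \<in> words X \<longleftrightarrow> u \<in> words X \<and> v \<in> words X"
  by (simp add: words_def)

lemma word_eq_words: "word_eq X R u v \<Longrightarrow> u \<in> words X \<and> v \<in> words X"
  by (induction rule: word_eq.induct) (auto simp: words_def)

lemma word_eq_context:
  "word_eq X R u v \<Longrightarrow> a \<in> words X \<Longrightarrow> b \<in> words X \<Longrightarrow> word_eq X R (a @ u @ b) (a @ v @ b)"
proof (induction rule: word_eq.induct)
  case (refl u)
  then show ?case by (auto intro: word_eq.refl)
next
  case (sym u v)
  then show ?case by (auto intro: word_eq.sym)
next
  case (trans u v w)
  then show ?case by (auto intro: word_eq.trans)
next
  case (cancel u v x c)
  then show ?case using word_eq.cancel[of "a @ u" X "v @ b" x R c] by simp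
next
  case (relator u v r)
  then show ?case using word_eq.relator[of "a @ u" X "v @ b" r R] by simp
qed

lemma word_eq_append:
  assumes "word_eq X R u u'" "word_eq X R v v'"
  shows "word_eq X R (u @ v) (u' @ v')"
proof -
  have "[] \<in> words X" by (simp add: words_def)
  then have "word_eq X R (u @ v) (u' @ v)" "word_eq X R (u' @ v) (u' @ v')"
    using word_eq_context[OF assms(1), of "[]" v] word_eq_context[OF assms(2), of u' "[]"]
      word_eq_words[OF assms(1)] word_eq_words[OF assms(2)] by auto
  then show ?thesis by (rule word_eq.trans)
qed

lemma inv_word_words: "w \<in> words X \<Longrightarrow> inv_word w \<in> words X"
  by (auto simp: words_def inv_word_def)

lemma word_eq_inv_word: "w \<in> words X \<Longrightarrow> word_eq X R (inv_word w @ w) []"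
proof (induction w)
  case Nil
  then show ?case by (auto simp: inv_word_def words_def intro: word_eq.refl)
next
  case (Cons l w)
  obtain x b where l: "l = (x, b)" by (cases l)
  have x: "x \<in> X" and w: "w \<in> words X" using Cons.prems by (auto simp: l words_def)
  have "inv_word (l # w) @ l # w = inv_word w @ [(x, \<not> b), (x, \<not> \<not> b)] @ w"
    by (simp add: l inv_word_def)
  then have "word_eq X R (inv_word (l # w) @ l # w) (inv_word w @ w)"
    using word_eq.cancel[OF inv_word_words[OF w] w x, where b = "\<not> b"] by (simp add: l)
  then show ?case using Cons.IH[OF w] by (rule word_eq.trans)
qed

lemma word_class_eq_iff:
  "u \<in> words X \<Longrightarrow> word_class X R u = word_class X R v \<longleftrightarrow> word_eq X R u v"
  unfolding word_class_def by (auto intro: word_eq.intros)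

lemma mult_presented_group:
  assumes "u \<in> words X" "v \<in> words X"
  shows "word_class X R u \<otimes>\<^bsub>presented_group X R\<^esub> word_class X R v = word_class X R (u @ v)"
  using assms unfolding presented_group_def word_class_def
  by (auto intro: word_eq.refl word_eq.trans word_eq_append)

lemma group_presented_group: "group (presented_group X R)"
proof (rule groupI)
  let ?G = "presented_group X R"
  have carrier: "carrier ?G = word_class X R ` words X"
    and one: "\<one>\<^bsub>?G\<^esub> = word_class X R []" and nil: "[] \<in> words X"
    by (auto simp: presented_group_def words_def)
  show "\<one>\<^bsub>?G\<^esub> \<in> carrier ?G" using nil by (simp add: carrier one)
  fix a assume "a \<in> carrier ?G"
  then obtain u where u: "u \<in> words X" "a = word_class X R u" by (auto simp: carrier)
  show "\<one>\<^bsub>?G\<^esub> \<otimes>\<^bsub>?G\<^esub> a = a" using u nil by (simp add: one mult_presented_group)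
  have "word_class X R (inv_word u) \<otimes>\<^bsub>?G\<^esub> a = \<one>\<^bsub>?G\<^esub>"
    using u by (simp add: one mult_presented_group inv_word_words word_class_eq_iff word_eq_inv_word)
  then show "\<exists>b\<in>carrier ?G. b \<otimes>\<^bsub>?G\<^esub> a = \<one>\<^bsub>?G\<^esub>" using u by (auto simp: carrier inv_word_words)
  fix b assume "b \<in> carrier ?G"
  then obtain v where v: "v \<in> words X" "b = word_class X R v" by (auto simp: carrier)
  show "a \<otimes>\<^bsub>?G\<^esub> b \<in> carrier ?G" using u v by (simp add: carrier mult_presented_group)
  fix c assume "c \<in> carrier ?G"
  then obtain w where w: "w \<in> words X" "c = word_class X R w" by (auto simp: carrier)
  show "a \<otimes>\<^bsub>?G\<^esub> b \<otimes>\<^bsub>?G\<^esub> c = a \<otimes>\<^bsub>?G\<^esub> (b \<otimes>\<^bsub>?G\<^esub> c)"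
    using u v w by (simp add: mult_presented_group)
qed

end

theory Submission
  imports Defs
begin

text \<open>
  Given \<open>P\<close>, \<open>ws\<close> and \<open>Q\<close>, search for words \<open>\<phi>\<close> over \<open>ws\<close>, one for each generator of \<open>Q\<close>, together
  with derivations in \<open>P\<close> showing that \<open>\<phi>\<close> kills the relators of \<open>Q\<close> and that each \<open>w\<^sub>i\<close> is the image
  of some word over the generators of \<open>Q\<close>.  Such \<open>\<phi>\<close> extends to an epimorphism from the group of \<open>Q\<close>
  onto the subgroup generated by \<open>ws\<close>.  If the two groups are isomorphic, such data exist, so the
  search halts; and composing the epimorphism with an isomorphism in the opposite direction gives a
  surjective endomorphism of a Hopfian group, so the epimorphism found is itself an isomorphism.
\<close>


section \<open>Computable functions on encoded types\<close>

class encodable =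
  fixes encode :: "'a \<Rightarrow> nat"
  assumes inj_encode: "inj encode"

lemma encode_eq_iff [simp]: "encode x = encode y \<longleftrightarrow> x = (y :: 'a::encodable)"
  using inj_encode by (auto dest: injD)

instantiation nat :: encodable
begin
definition encode_nat :: "nat \<Rightarrow> nat" where [simp]: "encode_nat n = n"
instance by standard (simp add: inj_def)
end

instantiation bool :: encodable
begin
definition encode_bool :: "bool \<Rightarrow> nat" where [simp]: "encode_bool b = of_bool b"
instance by standard (simp add: inj_def)
end

instantiation prod :: (encodable, encodable) encodable
begin
definition encode_prod :: "'a \<times> 'b \<Rightarrow> nat" where
  "encode_prod p = prod_encode (encode (fst p), encode (snd p))"
instance by standard (auto simp: inj_def encode_prod_def)
end

instantiation list :: (encodable) encodable
begin
definition encode_list :: "'a list \<Rightarrow> nat" where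
  "encode_list xs = list_encode (map encode xs)"
instance by standard (auto simp: inj_def encode_list_def list_encode_eq inj_map_eq_map[OF inj_encode])
end

lemma encode_Pair [simp]: "encode (x, y) = prod_encode (encode x, encode y)"
  by (simp add: encode_prod_def)

lemma encode_Nil [simp]: "encode [] = 0"
  and encode_Cons [simp]: "encode (x # xs) = Suc (prod_encode (encode x, encode xs))"
  by (simp_all add: encode_list_def)

text \<open>Each cons cell contributes a successor to the code, so the code itself can serve as an
  iteration bound for recursions over a list.\<close>

lemma length_le_encode: "length xs \<le> encode xs"
proof (induction xs)
  case (Cons x xs)
  then show ?case using le_prod_encode_2[of "encode xs" "encode x"] by simp
qed simp

text \<open>
  Realizers are total: a program may apply one to a number that is not a code, for instance in the
  branch of a conditional that is discarded.
\<close>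

definition computable :: "('a::encodable \<Rightarrow> 'b::encodable) \<Rightarrow> bool" where
  "computable f \<longleftrightarrow> (\<exists>g. partrec (\<lambda>n. Some (g n)) \<and> (\<forall>x. g (encode x) = encode (f x)))"

lemma computableI:
  "partrec (\<lambda>n. Some (g n)) \<Longrightarrow> (\<And>x. g (encode x) = encode (f x)) \<Longrightarrow> computable f"
  by (auto simp: computable_def)

lemma computable_partrec:
  "computable f \<longleftrightarrow> partrec (\<lambda>n. Some (f n))" for f :: "nat \<Rightarrow> nat"
  by (auto simp: computable_def)

lemma computable_realizer:
  assumes "computable f"
  obtains g :: "nat \<Rightarrow> nat" where "computable g" "\<And>x. g (encode x) = encode (f x)"
  using assms by (auto simp: computable_partrec) (auto simp: computable_def)

section \<open>Composition, pairing, decoding and primitive recursion\<close>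

lemma computable_compose:
  assumes "computable f" "computable g"
  shows "computable (\<lambda>x. f (g x))"
proof -
  obtain f' g' where *: "partrec (\<lambda>n. Some (f' n))" "\<forall>x. f' (encode x) = encode (f x)"
    "partrec (\<lambda>n. Some (g' n))" "\<forall>x. g' (encode x) = encode (g x)"
    using assms unfolding computable_def by blast
  show ?thesis
    using partrec.comp[OF *(1,3)] * by (intro computableI[of "\<lambda>n. f' (g' n)"]) auto
qed

lemma computable_Pair:
  assumes "computable f" "computable g"
  shows "computable (\<lambda>x. (f x, g x))"
proof -
  obtain f' g' where *: "partrec (\<lambda>n. Some (f' n))" "\<forall>x. f' (encode x) = encode (f x)"
    "partrec (\<lambda>n. Some (g' n))" "\<forall>x. g' (encode x) = encode (g x)"
    using assms unfolding computable_def by blast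
  show ?thesis
    using partrec.pair[OF *(1,3)] *
    by (intro computableI[of "\<lambda>n. prod_encode (f' n, g' n)"]) auto
qed

text \<open>Such a function is realized by the identity on numbers, which \<open>partrec\<close>
  yields by pairing the two projections.\<close>

lemma computable_same_code: "(\<And>x. encode (f x) = encode x) \<Longrightarrow> computable f"
  using partrec.pair[OF partrec.fst partrec.snd] by (intro computableI[of "\<lambda>n. n"]) simp_all

lemma computable_ident: "computable (\<lambda>x. x)"
  by (rule computable_same_code) simp

lemma computable_const: "computable (\<lambda>x. c)"
proof -
  have "partrec (\<lambda>_. Some n)" for n
    by (induction n) (use partrec.zero partrec.comp[OF partrec.succ] in fastforce)+
  then show ?thesis by (intro computableI[of "\<lambda>_. encode c"]) auto
qed

lemma computable_fst: "computable f \<Longrightarrow> computable (\<lambda>x. fst (f x))"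
  by (rule computable_compose[of fst])
    (auto intro!: computableI[of "\<lambda>n. fst (prod_decode n)"] partrec.fst)

lemma computable_snd: "computable f \<Longrightarrow> computable (\<lambda>x. snd (f x))"
  by (rule computable_compose[of snd])
    (auto intro!: computableI[of "\<lambda>n. snd (prod_decode n)"] partrec.snd)

lemma computable_Suc: "computable f \<Longrightarrow> computable (\<lambda>x. Suc (f x))"
  by (rule computable_compose[of Suc]) (simp add: computable_partrec partrec.succ)

lemma computable_encode: "computable f \<Longrightarrow> computable (\<lambda>x. encode (f x))"
  by (rule computable_compose[of encode]) (auto intro: computable_same_code)

text \<open>Decoding a number into a pair of numbers leaves its code unchanged.\<close>

lemma computable_prod_decode: "computable f \<Longrightarrow> computable (\<lambda>x. prod_decode (f x))"
  by (rule computable_compose[of prod_decode]) (auto intro: computable_same_code simp: encode_prod_def)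

lemma encode_nat_list: "encode = list_encode"
proof
  fix xs :: "nat list"
  show "encode xs = list_encode xs" by (induction xs) simp_all
qed

lemma computable_list_decode: "computable f \<Longrightarrow> computable (\<lambda>x. list_decode (f x))"
  by (rule computable_compose[of list_decode])
    (auto intro: computable_same_code simp: encode_nat_list)

lemma computable_rec_nat:
  assumes "computable f" "computable (\<lambda>p. g (fst p) (fst (snd p)) (snd (snd p)))" "computable k"
  shows "computable (\<lambda>x. rec_nat (f x) (\<lambda>m r. g x m r) (k x))"
proof -
  obtain f' g' where *: "partrec (\<lambda>n. Some (f' n))" "\<forall>x. f' (encode x) = encode (f x)"
    "partrec (\<lambda>n. Some (g' n))"
    "\<forall>p. g' (encode p) = encode (g (fst p) (fst (snd p)) (snd (snd p)))"
    using assms(1,2) unfolding computable_def by blast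
  define h where "h = (\<lambda>n. case prod_decode n of (a, k) \<Rightarrow>
    rec_nat (f' a) (\<lambda>m i. g' (prod_encode (a, prod_encode (m, i)))) k)"
  \<comment> \<open>Both realizers are total, so the recursion in the option type never reaches
    \<open>None\<close> and collapses to an ordinary recursion.\<close>
  have "rec_nat (Some (f' a)) (\<lambda>m r. Option.bind r
      (\<lambda>i. Some (g' (prod_encode (a, prod_encode (m, i)))))) k
    = Some (rec_nat (f' a) (\<lambda>m i. g' (prod_encode (a, prod_encode (m, i)))) k)" for a k
    by (induction k) simp_all
  then have "partrec (\<lambda>n. Some (h n))"
    using partrec.prec[OF *(1,3)] by (simp add: h_def case_prod_beta)
  moreover have "h (encode (x, k)) = encode (rec_nat (f x) (g x) k)" for x k
  proof -
    have "rec_nat (f' (encode x)) (\<lambda>m i. g' (prod_encode (encode x, prod_encode (m, i)))) k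
      = encode (rec_nat (f x) (g x) k)"
    proof (induction k)
      case (Suc k)
      then show ?case using *(4)[rule_format, of "(x, k, rec_nat (f x) (g x) k)"] by simp
    qed (simp add: *)
    then show ?thesis by (simp add: h_def)
  qed
  ultimately have "computable (\<lambda>p. rec_nat (f (fst p)) (g (fst p)) (snd p))"
    by (intro computableI[of h]) auto
  \<comment> \<open>So far the length of the recursion is an independent argument; composing with
    the map from \<open>x\<close> to \<open>(x, k x)\<close> ties it to \<open>x\<close>.\<close>
  from computable_compose[OF this computable_Pair[OF computable_ident assms(3)]]
  show ?thesis by simp
qed

named_theorems computable_intros

lemmas [computable_intros] = computable_const computable_ident computable_Pair computable_fst
  computable_snd computable_Suc computable_encode computable_prod_decode computable_list_decode

section \<open>Conditionals and Boolean connectives\<close>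

lemma computable_If [computable_intros]:
  assumes "computable c" "computable f" "computable g"
  shows "computable (\<lambda>x. if c x then f x else g x)"
proof -
  \<comment> \<open>The code of a condition is 0 or 1, so this recursion makes at most one step and
    acts as a case distinction.\<close>
  have "computable (\<lambda>x. rec_nat (g x) (\<lambda>_ _. f x) (encode (c x)))"
    by (intro computable_rec_nat computable_intros computable_compose[OF assms(2)] assms)
  moreover have "rec_nat (g x) (\<lambda>_ _. f x) (encode (c x)) = (if c x then f x else g x)" for x
    by simp
  ultimately show ?thesis by simp
qed

lemma computable_Not [computable_intros]:
  assumes "computable c" shows "computable (\<lambda>x. \<not> c x)"
  using computable_If[OF assms computable_const[of False] computable_const[of True]]
  by (simp add: if_bool_eq_conj)

lemma computable_conj [computable_intros]:
  assumes "computable c" "computable d" shows "computable (\<lambda>x. c x \<and> d x)"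
  using computable_If[OF assms computable_const[of False]] by (simp add: conj_commute if_bool_eq_conj cong: conj_cong)

lemma computable_disj [computable_intros]:
  assumes "computable c" "computable d" shows "computable (\<lambda>x. c x \<or> d x)"
  using computable_Not[OF computable_conj[OF computable_Not computable_Not, OF assms]] by simp

section \<open>Arithmetic and comparison\<close>

lemma computable_is_0:
  assumes "computable f" shows "computable (\<lambda>x. f x = (0 :: nat))"
proof -
  have "computable (\<lambda>x. rec_nat True (\<lambda>_ _. False) (f x))"
    by (intro computable_rec_nat computable_intros assms)
  moreover have "rec_nat True (\<lambda>_ _. False) n = (n = 0)" for n by (cases n) simp_all
  ultimately show ?thesis by simp
qed

lemma computable_pred:
  assumes "computable f" shows "computable (\<lambda>x. f x - Suc 0)"
proof -
  \<comment> \<open>A recursion of positive length \<open>n\<close> last visits the index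
    \<open>n - 1\<close>; returning that index gives the predecessor.\<close>
  have "computable (\<lambda>x. rec_nat 0 (\<lambda>m _. m) (f x))"
    by (intro computable_rec_nat computable_intros assms)
  moreover have "rec_nat 0 (\<lambda>m _. m) n = n - Suc 0" for n by (cases n) simp_all
  ultimately show ?thesis by simp
qed

lemma computable_diff [computable_intros]:
  assumes "computable f" "computable g" shows "computable (\<lambda>x. f x - g x :: nat)"
proof -
  have "computable (\<lambda>x. rec_nat (f x) (\<lambda>_ r. r - Suc 0) (g x))"
    by (intro computable_rec_nat computable_pred computable_intros assms)
  moreover have "rec_nat m (\<lambda>_ r. r - Suc 0) n = m - n" for m n by (induction n) simp_all
  ultimately show ?thesis by simp
qed

lemma computable_less [computable_intros]:
  assumes "computable f" "computable g" shows "computable (\<lambda>x. f x < (g x :: nat))"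
  using computable_Not[OF computable_is_0[OF computable_diff[OF assms(2,1)]]]
  by (simp add: not_le)

text \<open>Codes are injective, so equality on any encodable type reduces to comparing two
  numbers.\<close>

lemma computable_eq [computable_intros]:
  assumes "computable f" "computable g" shows "computable (\<lambda>x. f x = g x)"
proof -
  have "computable (\<lambda>x. \<not> encode (f x) < encode (g x) \<and> \<not> encode (g x) < encode (f x))"
    by (intro computable_intros assms)
  moreover have "\<not> encode a < encode b \<and> \<not> encode b < encode a \<longleftrightarrow> a = b" for a b :: 'b
    by (metis encode_eq_iff linorder_neqE_nat less_irrefl)
  ultimately show ?thesis by simp
qed

section \<open>List operations and quantifiers over lists\<close>

lemma computable_Cons [computable_intros]:
  assumes "computable f" "computable g" shows "computable (\<lambda>x. f x # g x)"
proof -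
  have "computable (\<lambda>p. fst p # snd p)"
    by (rule computableI[of Suc]) (auto simp: partrec.succ)
  from computable_compose[OF this computable_Pair[OF assms]] show ?thesis by simp
qed

text \<open>
  The fold runs on the code of the list: the state consists of the code of the unprocessed part
  and the accumulator, and the code of the whole list bounds the number of iterations.
\<close>

lemma computable_fold [computable_intros]:
  fixes l :: "'a::encodable \<Rightarrow> 'b::encodable list" and f :: "'a \<Rightarrow> 'c::encodable"
  assumes "computable (\<lambda>p. s (fst p) (fst (snd p)) (snd (snd p)))" "computable l" "computable f"
  shows "computable (\<lambda>x. fold (s x) (l x) (f x))"
proof -
  obtain s' :: "nat \<Rightarrow> nat" where s': "computable s'"
    and s'_eq: "\<And>p. s' (encode p) = encode (s (fst p) (fst (snd p)) (snd (snd p)))"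
    using computable_realizer[OF assms(1)] by blast
  \<comment> \<open>Code 0 is the empty list and fixes the state; from a nonzero code, subtracting
    one and decoding gives head and tail.\<close>
  define T where "T a m r = (if fst r = 0 then r else
    (snd (prod_decode (fst r - Suc 0)),
     s' (encode (a, fst (prod_decode (fst r - Suc 0)), snd r))))" for a m :: nat and r :: "nat \<times> nat"
  have "computable (\<lambda>x. snd (rec_nat (encode (l x), encode (f x)) (T (encode x)) (encode (l x))))"
    unfolding T_def by (intro computable_rec_nat computable_intros computable_is_0 computable_pred
      computable_compose[OF s'] assms)
  \<comment> \<open>The bound \<open>k\<close> may exceed the length: surplus iterations do nothing
    on an exhausted list.\<close>
  moreover have "rec_nat (encode ys, encode c) (T (encode x)) k = (0, encode (fold (s x) ys c))"
    if "length ys \<le> k" for x ys c k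
    using that
  proof (induction k arbitrary: ys c)
    \<comment> \<open>\<open>rec_nat\<close> unfolds at its last step while the list is consumed
      from the front; \<open>T\<close> ignores the index, so a step can be moved to the
      start.\<close>
    case (Suc k)
    have shift: "rec_nat r (T a) (Suc k) = rec_nat (T a 0 r) (T a) k" for r a
      by (induction k) (simp_all add: T_def)
    show ?case
    proof (cases ys)
      case Nil
      have "T (encode x) 0 (encode ys, encode c) = (encode ys, encode c)" by (simp add: T_def Nil)
      then show ?thesis using Suc.IH[of "[]" c] unfolding shift by (simp add: Nil)
    next
      case (Cons y zs)
      have "T (encode x) 0 (encode ys, encode c) = (encode zs, encode (s x y c))"
        using s'_eq[of "(x, y, c)"] by (simp add: T_def Cons)
      then show ?thesis using Suc.IH[of zs "s x y c"] Suc.prems unfolding shift by (simp add: Cons)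
    qed
  qed simp
  then have "rec_nat (encode (l x), encode (f x)) (T (encode x)) (encode (l x))
      = (0, encode (fold (s x) (l x) (f x)))" for x
    by (simp add: length_le_encode)
  ultimately have "computable (\<lambda>x. encode (fold (s x) (l x) (f x)))" by simp
  then show ?thesis by (auto simp: computable_def)
qed

lemma computable_rev [computable_intros]:
  assumes "computable l" shows "computable (\<lambda>x. rev (l x))"
proof -
  have "computable (\<lambda>x. fold (\<lambda>y r. y # r) (l x) [])" by (intro computable_intros assms)
  then show ?thesis by (simp add: fold_Cons_rev)
qed

lemma computable_append [computable_intros]:
  assumes "computable f" "computable g" shows "computable (\<lambda>x. f x @ g x)"
proof -
  have "computable (\<lambda>x. fold (\<lambda>y r. y # r) (rev (f x)) (g x))" by (intro computable_intros assms)
  then show ?thesis by (simp add: fold_Cons_rev)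
qed

lemma computable_map [computable_intros]:
  assumes "computable (\<lambda>p. f (fst p) (snd p))" "computable l"
  shows "computable (\<lambda>x. map (f x) (l x))"
proof -
  \<comment> \<open>The step of the fold also receives the accumulator, so \<open>f\<close> is first
    composed with the projection onto parameter and element.\<close>
  have "computable (\<lambda>x. rev (fold (\<lambda>y r. f x y # r) (l x) []))"
    using computable_compose[OF assms(1), of "\<lambda>p. (fst p, fst (snd p))"]
    by (intro computable_intros assms) (simp add: computable_intros)
  moreover have "rev (fold (\<lambda>y r. f x y # r) ys zs) = rev zs @ map (f x) ys" for x ys zs
    by (induction ys arbitrary: zs) simp_all
  ultimately show ?thesis by simp
qed

lemma computable_concat [computable_intros]:
  assumes "computable l" shows "computable (\<lambda>x. concat (l x))"
proof -
  have "computable (\<lambda>x. fold (\<lambda>y r. r @ y) (l x) [])" by (intro computable_intros assms)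
  moreover have "fold (\<lambda>y r. r @ y) ys r = r @ concat ys" for ys and r :: "'b list"
    by (induction ys arbitrary: r) simp_all
  ultimately show ?thesis by simp
qed

lemma computable_length [computable_intros]:
  assumes "computable l" shows "computable (\<lambda>x. length (l x))"
proof -
  have "computable (\<lambda>x. fold (\<lambda>y r. Suc r) (l x) 0)" by (intro computable_intros assms)
  moreover have "fold (\<lambda>y r. Suc r) ys r = r + length ys" for ys :: "'b list" and r
    by (induction ys arbitrary: r) simp_all
  ultimately show ?thesis by simp
qed

lemma computable_Ball_set [computable_intros]:
  assumes "computable (\<lambda>p. f (fst p) (snd p))" "computable l"
  shows "computable (\<lambda>x. \<forall>y\<in>set (l x). f x y)"
proof -
  have "computable (\<lambda>x. fold (\<lambda>y r. f x y \<and> r) (l x) True)"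
    using computable_compose[OF assms(1), of "\<lambda>p. (fst p, fst (snd p))"]
    by (intro computable_intros assms) (simp add: computable_intros)
  moreover have "fold (\<lambda>y r. f x y \<and> r) ys r \<longleftrightarrow> (\<forall>y\<in>set ys. f x y) \<and> r" for x ys r
    by (induction ys arbitrary: r) auto
  ultimately show ?thesis by simp
qed

lemma computable_Bex_set [computable_intros]:
  assumes "computable (\<lambda>p. f (fst p) (snd p))" "computable l"
  shows "computable (\<lambda>x. \<exists>y\<in>set (l x). f x y)"
  using computable_Not[OF computable_Ball_set[OF computable_Not[OF assms(1)] assms(2)]] by simp

text \<open>The default makes indexing total, since the value of \<open>xs ! i\<close> beyond the
  end of the list is not specified.\<close>

definition nth_default :: "'a \<Rightarrow> 'a list \<Rightarrow> nat \<Rightarrow> 'a" where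
  "nth_default d xs i = (if i < length xs then xs ! i else d)"

lemma computable_nth_default [computable_intros]:
  fixes l :: "'a::encodable \<Rightarrow> 'b::encodable list"
  assumes "computable l" "computable i"
  shows "computable (\<lambda>x. nth_default d (l x) (i x))"
proof -
  \<comment> \<open>The accumulator holds a position counter and the entry found so far, initially
    the default.\<close>
  have "computable (\<lambda>x. snd (fold (\<lambda>y r. (Suc (fst r), if fst r = i x then y else snd r)) (l x) (0, d)))"
    using computable_compose[OF assms(2), of fst]
    by (intro computable_intros assms) (simp add: computable_intros)
  moreover have "snd (fold (\<lambda>y r. (Suc (fst r), if fst r = j then y else snd r)) ys (n, d))
    = (if n \<le> j \<and> j < n + length ys then ys ! (j - n) else d)" for j n d and ys :: "'b list"
    by (induction ys arbitrary: n d) (auto simp: nth_Cons')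
  then have "snd (fold (\<lambda>y r. (Suc (fst r), if fst r = i x then y else snd r)) (l x) (0, d))
      = nth_default d (l x) (i x)" for x
    by (simp add: nth_default_def)
  ultimately show ?thesis by simp
qed


section \<open>Unbounded search\<close>

text \<open>
  Encodings need not be surjective (on \<^typ>\<open>bool\<close> the encoding is not), so the search runs over
  an enumeration instead of over codes.
\<close>

class enumerable = encodable +
  assumes partrec_enumeration: "\<exists>d :: nat \<Rightarrow> 'a. partrec (\<lambda>n. Some (encode (d n))) \<and> surj d"

lemma computable_from_nat:
  "computable d \<longleftrightarrow> partrec (\<lambda>n. Some (encode (d n)))" for d :: "nat \<Rightarrow> 'a::encodable"
  using computable_partrec[of "\<lambda>n. encode (d n)"] by (simp add: computable_def)

lemma enumeration_exists: "\<exists>d :: nat \<Rightarrow> 'a::enumerable. computable d \<and> surj d"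
  using partrec_enumeration by (simp add: computable_from_nat)

instance nat :: enumerable
  by standard (use computable_ident[where 'a = nat] in \<open>auto simp: computable_from_nat surj_def\<close>)

instance bool :: enumerable
proof (standard, fold computable_from_nat)
  show "\<exists>d :: nat \<Rightarrow> bool. computable d \<and> surj d"
    by (rule exI[of _ "\<lambda>n. n = 0"])
      (auto intro: computable_is_0 computable_ident simp: surj_def zero_less_Suc exI[of _ "Suc 0"])
qed

instance prod :: (enumerable, enumerable) enumerable
proof (standard, fold computable_from_nat)
  obtain d :: "nat \<Rightarrow> 'a" and e :: "nat \<Rightarrow> 'b" where *: "computable d" "surj d" "computable e" "surj e"
    using enumeration_exists by metis
  have "computable (\<lambda>n. (d (fst (prod_decode n)), e (snd (prod_decode n))))"
    by (intro computable_intros computable_compose[OF *(1)] computable_compose[OF *(3)])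
  moreover have "\<exists>n. p = (d (fst (prod_decode n)), e (snd (prod_decode n)))" for p
  proof -
    obtain m n where "fst p = d m" "snd p = e n" using * by (meson surjD)
    then show ?thesis by (intro exI[of _ "prod_encode (m, n)"]) (simp add: prod_eq_iff)
  qed
  ultimately show "\<exists>d :: nat \<Rightarrow> 'a \<times> 'b. computable d \<and> surj d"
    unfolding surj_def by blast
qed

instance list :: (enumerable) enumerable
proof (standard, fold computable_from_nat)
  obtain d :: "nat \<Rightarrow> 'a" where *: "computable d" "surj d"
    using enumeration_exists by metis
  have "computable (\<lambda>n. map d (list_decode n))"
    by (intro computable_intros computable_compose[OF *(1)])
  moreover have "\<exists>n. xs = map d (list_decode n)" for xs
  proof -
    have "xs = map d (list_decode (list_encode (map (inv_into UNIV d) xs)))"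
      using *(2) by (simp add: surj_f_inv_f o_def)
    then show ?thesis by blast
  qed
  ultimately show "\<exists>d :: nat \<Rightarrow> 'a list. computable d \<and> surj d"
    unfolding surj_def by blast
qed

text \<open>Minimization runs over the indices of a computable enumeration, and the least successful
  index is then turned into the code of a witness.\<close>

lemma partrec_search:
  fixes R :: "'a::encodable \<Rightarrow> 'b::enumerable \<Rightarrow> bool"
  assumes "computable (\<lambda>p. R (fst p) (snd p))"
  obtains f where "partrec f"
    "\<And>x. \<exists>y. R x y \<Longrightarrow> \<exists>y. R x y \<and> f (encode x) = Some (encode y)"
proof -
  obtain d :: "nat \<Rightarrow> 'b" where d: "computable d" "surj d" using enumeration_exists by metis
  \<comment> \<open>\<open>mu\<close> looks for a zero, hence the negated relation: success has code
    0 and failure code 1.\<close>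
  have "computable (\<lambda>p. \<not> R (fst p) (d (snd p)))"
    using computable_compose[OF assms computable_Pair[OF computable_fst computable_compose[OF d(1) computable_snd],
      OF computable_ident computable_ident]] by (intro computable_Not) simp
  then obtain c d' where c: "partrec (\<lambda>n. Some (c n))"
      "\<And>x n. c (prod_encode (encode x, n)) = of_bool (\<not> R x (d n))"
    and d': "partrec (\<lambda>n. Some (d' n))" "\<And>n. d' n = encode (d n)"
    using d(1) unfolding computable_def by (auto simp: encode_prod_def)
  define \<mu> where "\<mu> = (\<lambda>a. if \<exists>n. c (prod_encode (a, n)) = 0 \<and>
      (\<forall>m<n. \<exists>k. c (prod_encode (a, m)) = Suc k)
    then Some (LEAST n. c (prod_encode (a, n)) = 0) else None)"
  show ?thesis
  proof
    have "partrec \<mu>" using partrec.mu[OF c(1)] by (simp only: \<mu>_def option.inject)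
    from partrec.comp[OF d'(1) this] show "partrec (\<lambda>a. Option.bind (\<mu> a) (\<lambda>n. Some (d' n)))" .
    fix x assume "\<exists>y. R x y"
    then have ex: "\<exists>n. R x (d n)" using d(2) by (metis surjD)
    define N where "N = (LEAST n. R x (d n))"
    have N: "R x (d N)" "\<And>m. m < N \<Longrightarrow> \<not> R x (d m)"
      unfolding N_def using LeastI_ex[OF ex] not_less_Least by blast+
    have "c (prod_encode (encode x, N)) = 0 \<and> (\<forall>m<N. \<exists>k. c (prod_encode (encode x, m)) = Suc k)"
      using N by (simp add: c(2))
    moreover have "(LEAST n. c (prod_encode (encode x, n)) = 0) = N"
      by (simp add: c(2) N_def)
    ultimately have "\<mu> (encode x) = Some N"
      unfolding \<mu>_def by (metis (lifting))
    then have "Option.bind (\<mu> (encode x)) (\<lambda>n. Some (d' n)) = Some (encode (d N))"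
      by (simp add: d'(2))
    then show "\<exists>y. R x y \<and> Option.bind (\<mu> (encode x)) (\<lambda>n. Some (d' n)) = Some (encode y)"
      using N(1) by blast
  qed
qed


section \<open>Derivations\<close>

type_synonym rewrite_step = "nat word \<times> nat word \<times> nat \<times> bool \<times> nat word"

text \<open>
  A step \<open>(u, m, x, b, v)\<close> inserts or deletes \<open>m\<close> between \<open>u\<close> and \<open>v\<close>, where \<open>m\<close> is a relator or
  the trivial relator on the letter \<open>(x, b)\<close>.  Applying the same step twice has no effect, so
  derivations are reversible.
\<close>

definition rewrite :: "fin_pres \<Rightarrow> rewrite_step \<Rightarrow> nat word \<Rightarrow> nat word" where
  "rewrite P s w =
    (let u = fst s; m = fst (snd s); x = fst (snd (snd s)); b = fst (snd (snd (snd s)));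
         v = snd (snd (snd (snd s)))
     in if m \<in> set (snd P) \<or> (x < fst P \<and> m = [(x, b), (x, \<not> b)])
        then if w = u @ v then u @ m @ v else if w = u @ m @ v then u @ v else w
        else w)"

definition run_steps :: "fin_pres \<Rightarrow> rewrite_step list \<Rightarrow> nat word \<Rightarrow> nat word" where
  "run_steps P ss w = fold (rewrite P) ss w"

abbreviation pres_eq :: "fin_pres \<Rightarrow> nat word \<Rightarrow> nat word \<Rightarrow> bool" where
  "pres_eq P \<equiv> word_eq {..<fst P} (set (snd P))"

lemma rewrite_rewrite: "rewrite P s (rewrite P s w) = w"
  by (auto simp: rewrite_def Let_def)

text \<open>Soundness of a step: an applicable one inserts or deletes a relator or a trivial
  relator, and an inapplicable one changes nothing.\<close>

lemma word_eq_rewrite: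
  assumes "valid_pres P" "w \<in> words {..<fst P}"
  shows "pres_eq P w (rewrite P s w)"
proof -
  obtain u m x b v where s: "s = (u, m, x, b, v)" by (metis prod_cases5)
  let ?ok = "m \<in> set (snd P) \<or> (x < fst P \<and> m = [(x, b), (x, \<not> b)])"
  show ?thesis
  proof (cases "?ok \<and> (w = u @ v \<or> w = u @ m @ v)")
    case True
    then have uv: "u \<in> words {..<fst P}" "v \<in> words {..<fst P}" using assms(2) by (auto simp: words_def)
    have "pres_eq P (u @ m @ v) (u @ v)"
    proof (cases "m \<in> set (snd P)")
      case True
      then show ?thesis using assms(1) uv by (auto simp: valid_pres_def intro: word_eq.relator)
    next
      case False
      then show ?thesis using \<open>?ok \<and> _\<close> uv word_eq.cancel[of u _ v x _ b] by auto
    qed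
    then show ?thesis using True assms(2) word_eq.refl[OF assms(2)]
      by (auto simp: s rewrite_def Let_def intro: word_eq.sym)
  next
    case False
    then show ?thesis using assms by (auto simp: s rewrite_def Let_def intro: word_eq.refl)
  qed
qed

lemma word_eq_run_steps:
  assumes "valid_pres P" "w \<in> words {..<fst P}"
  shows "pres_eq P w (run_steps P ss w)"
  using assms(2) unfolding run_steps_def
proof (induction ss arbitrary: w)
  case (Cons s ss)
  have *: "pres_eq P w (rewrite P s w)" by (rule word_eq_rewrite[OF assms(1) Cons.prems])
  then show ?case using Cons.IH[of "rewrite P s w"] word_eq_words[OF *]
    by (auto intro: word_eq.trans)
qed (auto intro: word_eq.refl)

text \<open>Completeness of derivations: a generating move is a single step, transitivity
  concatenates and symmetry reverses.\<close>

lemma run_steps_exist: "pres_eq P w w' \<Longrightarrow> \<exists>ss. run_steps P ss w = w'"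
proof (induction rule: word_eq.induct)
  case (refl u)
  then show ?case by (auto simp: run_steps_def intro: exI[of _ "[]"])
next
  case (sym u v)
  then obtain ss where "run_steps P ss u = v" by blast
  \<comment> \<open>Each step is its own inverse, so running the list backwards undoes it.\<close>
  moreover have "fold (rewrite P) (rev ss) (fold (rewrite P) ss w) = w" for w
    by (induction ss arbitrary: w) (simp_all add: rewrite_rewrite)
  ultimately show ?case by (auto simp: run_steps_def)
next
  case (trans u v w)
  then obtain ss ts where "run_steps P ss u = v" "run_steps P ts v = w" by blast
  then show ?case by (auto simp: run_steps_def intro: exI[of _ "ss @ ts"])
next
  case (cancel u v x b)
  then have "run_steps P [(u, [(x, b), (x, \<not> b)], x, b, v)] (u @ [(x, b), (x, \<not> b)] @ v) = u @ v"
    by (simp add: run_steps_def rewrite_def)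
  then show ?case by blast
next
  case (relator u v r)
  \<comment> \<open>The letter \<open>(0, True)\<close> is a placeholder: the step is admissible
    because \<open>r\<close> is a relator.\<close>
  then have "run_steps P [(u, r, 0, True, v)] (u @ r @ v) = u @ v"
    by (simp add: run_steps_def rewrite_def)
  then show ?case by blast
qed

lemma computable_member [computable_intros]:
  assumes "computable f" "computable l" shows "computable (\<lambda>x. f x \<in> set (l x))"
proof -
  have "computable (\<lambda>x. \<exists>y\<in>set (l x). f x = y)"
    by (intro computable_intros assms computable_compose[OF assms(1)])
  then show ?thesis by simp
qed

lemma computable_rewrite [computable_intros]:
  assumes "computable f" "computable g" "computable h"
  shows "computable (\<lambda>x. rewrite (f x) (g x) (h x))"
proof -
  have "computable (\<lambda>p. rewrite (fst p) (fst (snd p)) (snd (snd p)))"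
    unfolding rewrite_def Let_def by (intro computable_intros)
  from computable_compose[OF this computable_Pair[OF assms(1) computable_Pair[OF assms(2,3)]]]
  show ?thesis by simp
qed

lemma computable_run_steps [computable_intros]:
  assumes "computable f" "computable g" "computable h"
  shows "computable (\<lambda>x. run_steps (f x) (g x) (h x))"
proof -
  have "computable (\<lambda>p. run_steps (fst p) (fst (snd p)) (snd (snd p)))"
    unfolding run_steps_def by (intro computable_intros)
  from computable_compose[OF this computable_Pair[OF assms(1) computable_Pair[OF assms(2,3)]]]
  show ?thesis by simp
qed


section \<open>Substitution and certificates\<close>

text \<open>
  Unlike \<^const>\<open>subst_word\<close>, this is specified on all inputs: letters out of range are erased.
\<close>

definition total_subst :: "nat word list \<Rightarrow> nat word \<Rightarrow> nat word" where
  "total_subst ws u = concat (map (\<lambda>l. if snd l then nth_default [] ws (fst l)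
     else rev (map (\<lambda>k. (fst k, \<not> snd k)) (nth_default [] ws (fst l)))) u)"

lemma total_subst_eq: "u \<in> words {..<length ws} \<Longrightarrow> total_subst ws u = subst_word ws u"
  unfolding total_subst_def subst_word_def inv_word_def words_def
  by (intro arg_cong[where f = concat] map_cong) (auto simp: nth_default_def case_prod_beta')

lemma computable_total_subst [computable_intros]:
  assumes "computable f" "computable g"
  shows "computable (\<lambda>x. total_subst (f x) (g x))"
proof -
  have "computable (\<lambda>p. total_subst (fst p) (snd p))"
    unfolding total_subst_def by (intro computable_intros)
  from computable_compose[OF this computable_Pair[OF assms]] show ?thesis by simp
qed

definition check_word :: "nat \<Rightarrow> nat word \<Rightarrow> bool" where
  "check_word n w \<longleftrightarrow> (\<forall>l\<in>set w. fst l < n)"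

lemma check_word_iff: "check_word n w \<longleftrightarrow> w \<in> words {..<n}"
  by (auto simp: check_word_def words_def lists_eq_set mem_Times_iff)

lemma computable_check_word [computable_intros]:
  assumes "computable f" "computable g"
  shows "computable (\<lambda>x. check_word (f x) (g x))"
proof -
  have "computable (\<lambda>p. check_word (fst p) (snd p))"
    unfolding check_word_def by (intro computable_intros)
  from computable_compose[OF this computable_Pair[OF assms]] show ?thesis by simp
qed

text \<open>
  The certificate \<open>(\<phi>, \<psi>, D)\<close> consists of the images \<open>\<phi>\<close> of the generators of \<open>Q\<close>, of words \<open>\<psi>\<close>
  over these generators, and of derivations \<open>D\<close> witnessing that \<open>\<phi>\<close> respects the relators of \<open>Q\<close>
  and that every word in \<open>ws\<close> is the image of a word in \<open>\<psi>\<close>.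
\<close>

type_synonym certificate = "nat word list \<times> nat word list \<times> rewrite_step list list"

definition certifies :: "fin_pres \<times> nat word list \<times> fin_pres \<Rightarrow> certificate \<Rightarrow> bool" where
  "certifies i c \<longleftrightarrow>
    (let P = fst i; ws = fst (snd i); Q = snd (snd i);
         \<phi> = fst c; \<psi> = fst (snd c); D = snd (snd c)
     in length \<phi> = fst Q \<and> (\<forall>u\<in>set \<phi>. check_word (length ws) u) \<and>
        (\<forall>v\<in>set \<psi>. check_word (fst Q) v) \<and>
        (\<forall>r\<in>set (snd Q). \<exists>d\<in>set D. run_steps P d (total_subst (map (total_subst ws) \<phi>) r) = []) \<and>
        (\<forall>w\<in>set ws. \<exists>v\<in>set \<psi>. \<exists>d\<in>set D. run_steps P d (total_subst (map (total_subst ws) \<phi>) v) = w))"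

text \<open>Every quantifier ranges over a list in the input or the certificate, so checking is
  decidable even where the word problem is not.\<close>

lemma computable_certifies: "computable (\<lambda>p. certifies (fst p) (snd p))"
  unfolding certifies_def Let_def by (intro computable_intros)


section \<open>Homomorphisms of presented groups\<close>

lemma group_grp: "group (grp P)"
  by (simp add: grp_def group_presented_group)

lemma carrier_grp: "carrier (grp P) = elt P ` words {..<fst P}"
  by (simp add: grp_def elt_def[abs_def] presented_group_def)

lemma elt_eq_iff: "u \<in> words {..<fst P} \<Longrightarrow> elt P u = elt P v \<longleftrightarrow> pres_eq P u v"
  by (simp add: elt_def word_class_eq_iff)

lemma elt_mult:
  assumes "u \<in> words {..<fst P}" "v \<in> words {..<fst P}"
  shows "elt P u \<otimes>\<^bsub>grp P\<^esub> elt P v = elt P (u @ v)"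
  using assms by (simp add: elt_def grp_def mult_presented_group)

lemma elt_Nil: "elt P [] = \<one>\<^bsub>grp P\<^esub>"
  by (simp add: elt_def grp_def presented_group_def)

lemma Nil_words [simp]: "[] \<in> words X"
  by (simp add: words_def)

lemma Cons_words [simp]: "l # w \<in> words X \<longleftrightarrow> fst l \<in> X \<and> w \<in> words X"
  by (cases l) (auto simp: words_def)

lemma elt_inv_word:
  assumes "u \<in> words {..<fst P}"
  shows "inv\<^bsub>grp P\<^esub> elt P u = elt P (inv_word u)"
proof (rule group.inv_equality[OF group_grp])
  show "elt P (inv_word u) \<otimes>\<^bsub>grp P\<^esub> elt P u = \<one>\<^bsub>grp P\<^esub>"
    using assms
    by (simp add: elt_mult inv_word_words elt_eq_iff word_eq_inv_word flip: elt_Nil)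
qed (use assms in \<open>auto simp: carrier_grp inv_word_words\<close>)

lemma inv_word_inv_word [simp]: "inv_word (inv_word u) = u"
  by (simp add: inv_word_def rev_map o_def case_prod_beta)

lemma inv_word_append: "inv_word (u @ v) = inv_word v @ inv_word u"
  by (simp add: inv_word_def)

section \<open>Substitution into words and the generated subgroup\<close>

lemma subst_word_simps [simp]:
  "subst_word ws [] = []"
  "subst_word ws ((i, b) # u) = (if b then ws ! i else inv_word (ws ! i)) @ subst_word ws u"
  "subst_word ws (u @ v) = subst_word ws u @ subst_word ws v"
  by (simp_all add: subst_word_def)

lemma subst_word_words:
  assumes "set ws \<subseteq> words X" "u \<in> words {..<length ws}"
  shows "subst_word ws u \<in> words X"
  using assms(2)
proof (induction u)
  case (Cons l u)
  then show ?case using assms(1) nth_mem[of "fst l" ws] by (cases l) (auto intro!: inv_word_words)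
qed simp

lemma subst_word_inv_word: "subst_word ws (inv_word u) = inv_word (subst_word ws u)"
proof (induction u)
  case (Cons l u)
  have "inv_word (l # u) = inv_word u @ [(fst l, \<not> snd l)]"
    by (simp add: inv_word_def case_prod_beta)
  then show ?case using Cons by (cases l) (auto simp: inv_word_append)
qed (simp add: inv_word_def)

text \<open>Used to exhibit the images of words over the generators of \<open>Q\<close> as words
  over \<open>ws\<close>, which places them in the subgroup.\<close>

lemma subst_word_map:
  assumes "u \<in> words {..<length \<phi>}"
  shows "subst_word (map (subst_word ws) \<phi>) u = subst_word ws (subst_word \<phi> u)"
  using assms by (induction u) (auto simp: subst_word_inv_word)

text \<open>The rules of \<open>generate\<close> match the empty word, single letters of either sign
  and concatenation.\<close>

lemma carrier_sub_grp:
  assumes "set ws \<subseteq> words {..<fst P}"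
  shows "carrier (sub_grp P ws) = (\<lambda>u. elt P (subst_word ws u)) ` words {..<length ws}"
proof -
  interpret group "grp P" by (rule group_grp)
  let ?S = "elt P ` set ws"
  \<comment> \<open>\<open>subgroup_generated\<close> intersects its generators with the carrier;
    here they already lie in it.\<close>
  have S: "carrier (grp P) \<inter> ?S = ?S" using assms by (auto simp: carrier_grp)
  have mem: "subst_word ws u \<in> words {..<fst P}" if "u \<in> words {..<length ws}" for u
    using subst_word_words[OF assms that] .
  have "generate (grp P) ?S = (\<lambda>u. elt P (subst_word ws u)) ` words {..<length ws}"
  proof
    show "generate (grp P) ?S \<subseteq> (\<lambda>u. elt P (subst_word ws u)) ` words {..<length ws}"
    proof
      fix a assume "a \<in> generate (grp P) ?S"
      then show "a \<in> (\<lambda>u. elt P (subst_word ws u)) ` words {..<length ws}"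
      proof induction
        case one
        then show ?case by (intro image_eqI[of _ _ "[]"]) (simp_all add: elt_Nil)
      next
        case (incl a)
        then obtain i where "i < length ws" "a = elt P (ws ! i)" by (auto simp: in_set_conv_nth)
        then show ?case by (intro image_eqI[of _ _ "[(i, True)]"]) simp_all
      next
        case (inv a)
        then obtain i where "i < length ws" "a = elt P (ws ! i)" by (auto simp: in_set_conv_nth)
        then show ?case using assms
          by (intro image_eqI[of _ _ "[(i, False)]"]) (auto simp: elt_inv_word nth_mem subset_iff)
      next
        case (eng a b)
        then obtain u v where "u \<in> words {..<length ws}" "v \<in> words {..<length ws}"
          "a = elt P (subst_word ws u)" "b = elt P (subst_word ws v)" by blast
        then show ?case by (intro image_eqI[of _ _ "u @ v"]) (simp_all add: elt_mult mem)
      qed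
    qed
  next
    have "elt P (subst_word ws u) \<in> generate (grp P) ?S" if "u \<in> words {..<length ws}" for u
      using that
    proof (induction u)
      case Nil
      then show ?case by (simp add: elt_Nil generate.one)
    next
      case (Cons l u)
      obtain i b where l: "l = (i, b)" by (cases l)
      have i: "ws ! i \<in> set ws" and u: "u \<in> words {..<length ws}" using Cons.prems by (auto simp: l)
      let ?w = "if b then ws ! i else inv_word (ws ! i)"
      have w: "ws ! i \<in> words {..<fst P}" using i assms by blast
      have "elt P ?w \<in> generate (grp P) ?S"
        using i w by (auto intro: generate.incl generate.inv simp flip: elt_inv_word)
      then have "elt P ?w \<otimes>\<^bsub>grp P\<^esub> elt P (subst_word ws u) \<in> generate (grp P) ?S"
        using Cons.IH[OF u] by (rule generate.eng)
      then show ?case using w mem[OF u] by (simp add: l elt_mult inv_word_words)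
    qed
    then show "(\<lambda>u. elt P (subst_word ws u)) ` words {..<length ws} \<subseteq> generate (grp P) ?S" by blast
  qed
  then show ?thesis by (simp add: sub_grp_def carrier_subgroup_generated S)
qed

lemma mult_sub_grp: "x \<otimes>\<^bsub>sub_grp P ws\<^esub> y = x \<otimes>\<^bsub>grp P\<^esub> y"
  by (simp add: sub_grp_def subgroup_generated_def)

lemma carrier_sub_grp_subset: "carrier (sub_grp P ws) \<subseteq> carrier (grp P)"
  unfolding sub_grp_def by (rule group.carrier_subgroup_generated_subset[OF group_grp])

lemma group_sub_grp: "group (sub_grp P ws)"
  unfolding sub_grp_def by (rule group.group_subgroup_generated[OF group_grp])

text \<open>A relator of \<open>Q\<close> becomes a trivial word of \<open>P\<close>, and a
  cancelling pair becomes a word next to its inverse, so each move survives the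
  substitution.\<close>

lemma subst_word_respects_eq:
  assumes "pres_eq Q u v" "length \<Phi> = fst Q" "set \<Phi> \<subseteq> words {..<fst P}"
    and rel: "\<And>r. r \<in> set (snd Q) \<Longrightarrow> pres_eq P (subst_word \<Phi> r) []"
  shows "pres_eq P (subst_word \<Phi> u) (subst_word \<Phi> v)"
proof -
  have mem: "subst_word \<Phi> u \<in> words {..<fst P}" if "u \<in> words {..<fst Q}" for u
    using subst_word_words[OF assms(3)] that assms(2) by simp
  show ?thesis using assms(1)
  proof induction
    case (refl u)
    then show ?case by (intro word_eq.refl mem)
  next
    case (sym u v)
    show ?case by (rule word_eq.sym) (rule sym.IH)
  next
    case (trans u v w)
    then show ?case by (blast intro: word_eq.trans)
  next
    case (cancel u v x b)
    let ?w = "\<Phi> ! x"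
    have w: "?w \<in> words {..<fst P}" using cancel assms(2,3) nth_mem by fastforce
    \<comment> \<open>Both orders of the pair occur; as \<open>inv_word\<close> is an involution,
      the cancellation applied to \<open>inv_word ?w\<close> covers the second one.\<close>
    have "pres_eq P (subst_word \<Phi> [(x, b), (x, \<not> b)]) []"
      using word_eq_inv_word[OF w] word_eq_inv_word[OF inv_word_words[OF w]] by simp
    from word_eq_context[OF this mem[OF cancel(1)] mem[OF cancel(2)]] show ?case
      by (metis append_Nil subst_word_simps(3))
  next
    case (relator u v r)
    from word_eq_context[OF rel[OF relator(3)] mem[OF relator(1)] mem[OF relator(2)]] show ?case
      by simp
  qed
qed

text \<open>An assignment on generators that kills the relators is well defined on classes, so any
  choice of representatives gives a homomorphism.\<close>

lemma von_Dyck: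
  assumes "length \<phi> = fst Q" "set \<phi> \<subseteq> words {..<length ws}" "set ws \<subseteq> words {..<fst P}"
    and rel: "\<And>r. r \<in> set (snd Q) \<Longrightarrow> pres_eq P (subst_word (map (subst_word ws) \<phi>) r) []"
  obtains h where "h \<in> hom (grp Q) (sub_grp P ws)"
    "\<And>u. u \<in> words {..<fst Q} \<Longrightarrow> h (elt Q u) = elt P (subst_word (map (subst_word ws) \<phi>) u)"
proof -
  define \<Phi> where "\<Phi> = map (subst_word ws) \<phi>"
  define h where "h a = elt P (subst_word \<Phi> (inv_into (words {..<fst Q}) (elt Q) a))" for a
  have \<Phi>: "length \<Phi> = fst Q" "set \<Phi> \<subseteq> words {..<fst P}"
    using assms subst_word_words[OF assms(3)] by (auto simp: \<Phi>_def)
  have mem: "subst_word \<Phi> u \<in> words {..<fst P}" if "u \<in> words {..<fst Q}" for u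
    using subst_word_words[OF \<Phi>(2)] that \<Phi>(1) by simp
  have h: "h (elt Q u) = elt P (subst_word \<Phi> u)" if "u \<in> words {..<fst Q}" for u
  proof -
    let ?v = "inv_into (words {..<fst Q}) (elt Q) (elt Q u)"
    have v: "?v \<in> words {..<fst Q}" "elt Q ?v = elt Q u"
      using that by (simp_all add: inv_into_into f_inv_into_f)
    then have "pres_eq Q ?v u" by (simp add: elt_eq_iff)
    from subst_word_respects_eq[OF this \<Phi> rel[folded \<Phi>_def]] show ?thesis
      by (simp add: h_def elt_eq_iff mem v)
  qed
  have "h \<in> hom (grp Q) (sub_grp P ws)"
  proof (rule homI)
    fix a b assume "a \<in> carrier (grp Q)" "b \<in> carrier (grp Q)"
    then obtain u v where *: "u \<in> words {..<fst Q}" "a = elt Q u" "v \<in> words {..<fst Q}" "b = elt Q v"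
      by (auto simp: carrier_grp)
    \<comment> \<open>Substituting in two stages shows the image as a word in \<open>ws\<close>,
      hence as an element of the subgroup.\<close>
    have "subst_word \<Phi> u = subst_word ws (subst_word \<phi> u)"
      using * assms(1) by (simp add: \<Phi>_def subst_word_map)
    then show "h a \<in> carrier (sub_grp P ws)"
      using * assms subst_word_words[OF assms(2), of u] by (auto simp: h carrier_sub_grp)
    show "h (a \<otimes>\<^bsub>grp Q\<^esub> b) = h a \<otimes>\<^bsub>sub_grp P ws\<^esub> h b"
      using * by (simp add: elt_mult h mem mult_sub_grp)
  qed
  then show ?thesis using h that by (simp add: \<Phi>_def)
qed

lemma hom_elt:
  assumes "h \<in> hom (grp Q) (grp P)" "length \<Phi> = fst Q" "set \<Phi> \<subseteq> words {..<fst P}"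
    and gen: "\<And>y. y < fst Q \<Longrightarrow> h (elt Q [(y, True)]) = elt P (\<Phi> ! y)"
    and "u \<in> words {..<fst Q}"
  shows "h (elt Q u) = elt P (subst_word \<Phi> u)"
  using assms(5)
proof (induction u)
  case Nil
  then show ?case using hom_one[OF assms(1) group_grp group_grp] by (simp add: elt_Nil)
next
  case (Cons l u)
  obtain y b where l: "l = (y, b)" by (cases l)
  have y: "y < fst Q" and u: "u \<in> words {..<fst Q}" using Cons.prems by (auto simp: l)
  interpret group_hom "grp Q" "grp P" h
    by (simp add: group_hom_def group_hom_axioms_def group_grp assms(1))
  have w: "\<Phi> ! y \<in> words {..<fst P}" using y assms(2,3) by (metis nth_mem subsetD)
  have letter: "h (elt Q [(y, b)]) = elt P (if b then \<Phi> ! y else inv_word (\<Phi> ! y))"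
  proof (cases b)
    case False
    have "elt Q [(y, False)] = inv\<^bsub>grp Q\<^esub> elt Q [(y, True)]"
      using y by (simp add: elt_inv_word inv_word_def)
    moreover have "elt Q [(y, True)] \<in> carrier (grp Q)" using y by (simp add: carrier_grp)
    ultimately show ?thesis using False gen[OF y] w by (simp add: elt_inv_word)
  qed (simp add: gen y)
  have "h (elt Q (l # u)) = h (elt Q [(y, b)] \<otimes>\<^bsub>grp Q\<^esub> elt Q u)"
    using y u by (simp add: elt_mult l)
  also have "\<dots> = h (elt Q [(y, b)]) \<otimes>\<^bsub>grp P\<^esub> h (elt Q u)"
    using y u by (intro hom_mult) (auto simp: carrier_grp)
  also have "\<dots> = elt P (subst_word \<Phi> (l # u))"
    using letter Cons.IH[OF u] w subst_word_words[OF assms(3)] u assms(2)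
    by (simp add: l elt_mult inv_word_words)
  finally show ?case .
qed

text \<open>For an isomorphism \<open>k\<close> from \<open>G\<close> to \<open>H\<close>,
  \<open>h \<circ> k\<close> is a surjective endomorphism of \<open>G\<close>, hence injective; as
  \<open>k\<close> is onto \<open>H\<close>, \<open>h\<close> is injective too.\<close>

lemma epi_hopfian_iso:
  assumes "hopfian G" "G \<cong> H" "h \<in> epi H G" "group G" "group H"
  shows "h \<in> iso H G"
proof -
  obtain k where k: "k \<in> iso G H" using assms(2) by (auto simp: is_iso_def)
  then have "k \<in> epi G H" by (simp add: iso_iff_mon_epi)
  then have "h \<circ> k \<in> epi G G" using assms(3) by (rule epi_compose)
  then have hk: "h \<circ> k \<in> iso G G" using assms(1) by (simp add: hopfian_def)
  show ?thesis
    unfolding iso_def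
  proof (safe intro!: bij_betw_imageI)
    show "h \<in> hom H G" using assms(3) by (simp add: epi_def)
    show "inj_on h (carrier H)"
    proof (rule inj_onI)
      fix a b assume "a \<in> carrier H" "b \<in> carrier H" "h a = h b"
      moreover from calculation obtain a' b' where "a' \<in> carrier G" "b' \<in> carrier G" "a = k a'" "b = k b'"
        using k by (metis (no_types, lifting) iso_iff imageE)
      ultimately show "a = b" using hk by (auto simp: iso_iff inj_on_def)
    qed
  qed (use assms(3) in \<open>auto simp: epi_def\<close>)
qed


section \<open>Certificates of isomorphism\<close>

text \<open>Soundness of the search: the derivations give an epimorphism, and the Hopf property
  makes it an isomorphism, whichever certificate is found.\<close>

lemma certifies_imp_identifies:
  assumes "valid_pres P" "valid_pres Q" "set ws \<subseteq> words {..<fst P}"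
    and "hopfian (sub_grp P ws)" "sub_grp P ws \<cong> grp Q"
    and cert: "certifies (P, ws, Q) (\<phi>, \<psi>, D)"
  shows "identifies_subgroup P ws Q \<phi>"
proof -
  have \<phi>: "length \<phi> = fst Q" "set \<phi> \<subseteq> words {..<length ws}" "set \<psi> \<subseteq> words {..<fst Q}"
    using cert by (auto simp: certifies_def Let_def check_word_iff)
  define \<Phi> where "\<Phi> = map (subst_word ws) \<phi>"
  have map: "map (total_subst ws) \<phi> = \<Phi>"
    using \<phi>(2) by (auto simp: \<Phi>_def total_subst_eq)
  have \<Phi>: "length \<Phi> = fst Q" "set \<Phi> \<subseteq> words {..<fst P}"
    using \<phi> subst_word_words[OF assms(3)] by (auto simp: \<Phi>_def)
  have mem: "subst_word \<Phi> u \<in> words {..<fst P}" if "u \<in> words {..<fst Q}" for u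
    using subst_word_words[OF \<Phi>(2)] that \<Phi>(1) by simp
  have eq: "pres_eq P (subst_word \<Phi> u) w" if "run_steps P d (total_subst \<Phi> u) = w" "u \<in> words {..<fst Q}" for u w d
    using word_eq_run_steps[OF assms(1) mem[OF that(2)], of d] that \<Phi>(1) by (simp add: total_subst_eq)
  have rel: "pres_eq P (subst_word \<Phi> r) []" if r: "r \<in> set (snd Q)" for r
  proof -
    obtain d where "run_steps P d (total_subst \<Phi> r) = []"
      using cert r by (auto simp: certifies_def Let_def map)
    moreover have "r \<in> words {..<fst Q}" using r assms(2) by (auto simp: valid_pres_def)
    ultimately show ?thesis by (rule eq)
  qed
  obtain h where h: "h \<in> hom (grp Q) (sub_grp P ws)"
    and h_elt: "\<And>u. u \<in> words {..<fst Q} \<Longrightarrow> h (elt Q u) = elt P (subst_word \<Phi> u)"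
    using von_Dyck[OF \<phi>(1,2) assms(3) rel[unfolded \<Phi>_def]] unfolding \<Phi>_def by blast
  interpret h: group_hom "grp Q" "sub_grp P ws" h
    by (simp add: group_hom_def group_hom_axioms_def group_grp group_sub_grp h)
  have "elt P w \<in> h ` carrier (grp Q)" if w: "w \<in> set ws" for w
  proof -
    obtain v d where v: "v \<in> set \<psi>" "run_steps P d (total_subst \<Phi> v) = w"
      using cert w by (auto simp: certifies_def Let_def map)
    then have "v \<in> words {..<fst Q}" using \<phi>(3) by blast
    with eq[OF v(2) this] have "elt P w = h (elt Q v)" "elt Q v \<in> carrier (grp Q)"
      by (simp_all add: carrier_grp h_elt elt_eq_iff[symmetric] mem)
    then show ?thesis by (rule image_eqI)
  qed
  \<comment> \<open>The image is a subgroup of the whole group that contains the generators, so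
    minimality of the generated subgroup gives surjectivity.\<close>
  moreover have "subgroup (h ` carrier (grp Q)) (grp P)"
    using h.img_is_subgroup
    unfolding sub_grp_def by (simp add: group.subgroup_subgroup_generated_iff[OF group_grp])
  ultimately have "carrier (sub_grp P ws) \<subseteq> h ` carrier (grp Q)"
    using group.subgroup_generated_minimal[OF group_grp, of "h ` carrier (grp Q)" P "elt P ` set ws"]
    by (simp add: sub_grp_def image_subset_iff)
  then have "h \<in> epi (grp Q) (sub_grp P ws)" using h by (simp add: epi_iff_subset)
  then have "h \<in> iso (grp Q) (sub_grp P ws)"
    by (rule epi_hopfian_iso[OF assms(4,5) _ group_sub_grp group_grp])
  moreover have "h (elt Q [(y, True)]) = elt P (subst_word ws (\<phi> ! y))" if "y < fst Q" for y
    using h_elt[of "[(y, True)]"] that \<phi>(1) by (simp add: \<Phi>_def)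
  ultimately show ?thesis using \<phi> by (auto simp: identifies_subgroup_def)
qed

text \<open>Termination of the search: an isomorphism supplies \<open>\<phi>\<close> by its values
  on generators, its surjectivity supplies \<open>\<psi>\<close>, and completeness of derivations
  supplies \<open>D\<close>.\<close>

lemma certificate_exists:
  assumes "valid_pres Q" "set ws \<subseteq> words {..<fst P}" "sub_grp P ws \<cong> grp Q"
  shows "\<exists>c. certifies (P, ws, Q) c"
proof -
  have "grp Q \<cong> sub_grp P ws" using assms(3) group.iso_sym[OF group_sub_grp] by blast
  then obtain h where h: "h \<in> iso (grp Q) (sub_grp P ws)" by (auto simp: is_iso_def)
  \<comment> \<open>With the whole group as target, \<open>h\<close> can be evaluated on words by
    \<open>hom_elt\<close>.\<close>
  have h_hom: "h \<in> hom (grp Q) (grp P)"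
    using h carrier_sub_grp_subset[of P ws] by (auto simp: iso_def hom_def mult_sub_grp)
  have img: "h ` carrier (grp Q) = carrier (sub_grp P ws)"
    using h by (simp add: iso_iff)
  have "\<exists>u \<in> words {..<length ws}. h (elt Q [(y, True)]) = elt P (subst_word ws u)" if "y < fst Q" for y
  proof -
    have "elt Q [(y, True)] \<in> carrier (grp Q)" using that by (simp add: carrier_grp)
    then have "h (elt Q [(y, True)]) \<in> carrier (sub_grp P ws)" using img by blast
    then show ?thesis by (auto simp: carrier_sub_grp[OF assms(2)])
  qed
  then obtain U where U: "\<And>y. y < fst Q \<Longrightarrow> U y \<in> words {..<length ws}"
    "\<And>y. y < fst Q \<Longrightarrow> h (elt Q [(y, True)]) = elt P (subst_word ws (U y))"
    by metis
  define \<phi> where "\<phi> = map U [0..<fst Q]"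
  define \<Phi> where "\<Phi> = map (subst_word ws) \<phi>"
  have \<phi>: "length \<phi> = fst Q" "set \<phi> \<subseteq> words {..<length ws}" using U(1) by (auto simp: \<phi>_def)
  have map: "map (total_subst ws) \<phi> = \<Phi>"
    using \<phi>(2) by (auto simp: \<Phi>_def total_subst_eq)
  have \<Phi>: "length \<Phi> = fst Q" "set \<Phi> \<subseteq> words {..<fst P}"
    using \<phi> subst_word_words[OF assms(2)] by (auto simp: \<Phi>_def)
  have mem: "subst_word \<Phi> u \<in> words {..<fst P}" if "u \<in> words {..<fst Q}" for u
    using subst_word_words[OF \<Phi>(2)] that \<Phi>(1) by simp
  have h_elt: "h (elt Q u) = elt P (subst_word \<Phi> u)" if "u \<in> words {..<fst Q}" for u
    using hom_elt[OF h_hom \<Phi> _ that] U(2) by (simp add: \<Phi>_def \<phi>_def)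
  have rel: "pres_eq P (subst_word \<Phi> r) []" if r: "r \<in> set (snd Q)" for r
  proof -
    have r': "r \<in> words {..<fst Q}" using r assms(1) by (auto simp: valid_pres_def)
    have "pres_eq Q r []" using word_eq.relator[of "[]" _ "[]" r] r r' by simp
    then have "elt Q r = elt Q []" using r' by (simp add: elt_eq_iff)
    then show ?thesis using h_elt[OF r'] h_elt[of "[]"] mem[OF r']
      by (auto simp: elt_eq_iff intro: word_eq.sym)
  qed
  have gen: "\<exists>v\<in>words {..<fst Q}. pres_eq P (subst_word \<Phi> v) w" if w: "w \<in> set ws" for w
  proof -
    have "elt P w \<in> carrier (sub_grp P ws)"
      unfolding sub_grp_def using w assms(2)
      by (auto simp: carrier_subgroup_generated carrier_grp intro!: generate.incl)
    then obtain v where "v \<in> words {..<fst Q}" "elt P w = h (elt Q v)"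
      unfolding img[symmetric] by (auto simp: carrier_grp)
    then show ?thesis using h_elt[of v] mem[of v] by (metis elt_eq_iff)
  qed
  obtain V where V: "\<And>w. w \<in> set ws \<Longrightarrow> V w \<in> words {..<fst Q} \<and> pres_eq P (subst_word \<Phi> (V w)) w"
    using gen by metis
  obtain d where d: "\<And>u w. pres_eq P u w \<Longrightarrow> run_steps P (d u w) u = w"
    using run_steps_exist by metis
  \<comment> \<open>One pooled list serves both kinds of derivation, since \<open>certifies\<close>
    only asks for some suitable member of \<open>D\<close> each time.\<close>
  define D where "D = map (\<lambda>r. d (subst_word \<Phi> r) []) (snd Q) @ map (\<lambda>w. d (subst_word \<Phi> (V w)) w) ws"
  have total: "total_subst \<Phi> u = subst_word \<Phi> u" if "u \<in> words {..<fst Q}" for u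
    using that \<Phi>(1) by (simp add: total_subst_eq)
  have "certifies (P, ws, Q) (\<phi>, map V ws, D)"
    unfolding certifies_def Let_def fst_conv snd_conv map check_word_iff
  proof (intro conjI ballI)
    fix r assume r: "r \<in> set (snd Q)"
    then have "run_steps P (d (subst_word \<Phi> r) []) (total_subst \<Phi> r) = []"
      using d[OF rel[OF r]] total[of r] assms(1) by (auto simp: valid_pres_def)
    then show "\<exists>d\<in>set D. run_steps P d (total_subst \<Phi> r) = []" using r by (auto simp: D_def)
  next
    fix w assume w: "w \<in> set ws"
    then have "run_steps P (d (subst_word \<Phi> (V w)) w) (total_subst \<Phi> (V w)) = w"
      using d V[OF w] total by simp
    then show "\<exists>v\<in>set (map V ws). \<exists>d\<in>set D. run_steps P d (total_subst \<Phi> v) = w"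
      using w by (auto simp: D_def)
  qed (use \<phi> V in auto)
  then show ?thesis ..
qed

section \<open>Agreement of the encodings, and solution of the identification problem\<close>

lemma encode_word_eq: "encode_word w = encode w"
  by (auto simp: encode_word_def encode_list_def encode_prod_def intro!: arg_cong[where f = list_encode])

lemma encode_words_eq: "encode_words ws = encode ws"
  by (simp add: encode_words_def encode_list_def[of ws] encode_word_eq[abs_def])

lemma encode_pres_eq: "encode_pres P = encode P"
  by (simp add: encode_pres_def encode_prod_def encode_words_eq)

lemmas encode_eqs = encode_words_eq encode_pres_eq

lemma hopfian_sub_grp:
  assumes "locally_hopfian (grp P)" "set ws \<subseteq> words {..<fst P}"
  shows "hopfian (sub_grp P ws)"
proof -
  have "finite (elt P ` set ws)" "elt P ` set ws \<subseteq> carrier (grp P)"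
    using assms(2) by (auto simp: carrier_grp)
  then show ?thesis using assms(1) unfolding locally_hopfian_def sub_grp_def by blast
qed

lemma subgroup_identification_locally_hopfian:
  "subgroup_identification_uniformly_solvable locally_hopfian"
proof -
  obtain f where f: "partrec f"
    "\<And>i. \<exists>c. certifies i c \<Longrightarrow> \<exists>c. certifies i c \<and> f (encode i) = Some (encode c)"
    using partrec_search[OF computable_certifies] by blast
  \<comment> \<open>Only \<open>\<phi>\<close> is to be returned, so the search is followed by this
    projection.\<close>
  have "computable (\<lambda>c :: certificate. fst c)"
    by (intro computable_intros)
  then obtain g where g: "partrec (\<lambda>n. Some (g n))" "\<And>c :: certificate. g (encode c) = encode (fst c)"
    unfolding computable_def by blast
  show ?thesis
    unfolding subgroup_identification_uniformly_solvable_def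
  proof (intro exI[of _ "\<lambda>n. Option.bind (f n) (\<lambda>n. Some (g n))"] conjI allI impI)
    show "partrec (\<lambda>n. Option.bind (f n) (\<lambda>n. Some (g n)))"
      by (rule partrec.comp[OF g(1) f(1)])
    fix P ws Q
    assume "valid_pres P \<and> locally_hopfian (grp P) \<and> set ws \<subseteq> words {..<fst P} \<and> valid_pres Q \<and>
      sub_grp P ws \<cong> grp Q"
    then have *: "valid_pres P" "locally_hopfian (grp P)" "set ws \<subseteq> words {..<fst P}" "valid_pres Q"
      "sub_grp P ws \<cong> grp Q"
      by simp_all
    obtain c where c: "certifies (P, ws, Q) c" "f (encode (P, ws, Q)) = Some (encode c)"
      using f(2)[OF certificate_exists[OF *(4,3,5)]] by blast
    obtain \<phi> \<psi> D where c_eq: "c = (\<phi>, \<psi>, D)" by (metis prod_cases3)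
    have "identifies_subgroup P ws Q \<phi>"
      using certifies_imp_identifies[OF *(1,4,3) hopfian_sub_grp[OF *(2,3)] *(5)] c(1) by (simp add: c_eq)
    moreover have "Option.bind (f (prod_encode (encode_pres P, prod_encode (encode_words ws, encode_pres Q))))
        (\<lambda>n. Some (g n)) = Some (encode_words \<phi>)"
      using c(2) g(2)[of c] by (simp add: encode_eqs c_eq)
    ultimately show "\<exists>\<phi>. Option.bind (f (prod_encode (encode_pres P, prod_encode (encode_words ws, encode_pres Q))))
        (\<lambda>n. Some (g n)) = Some (encode_words \<phi>) \<and> identifies_subgroup P ws Q \<phi>"
      by blast
  qed
qed

section \<open>Weak and strong effective coherence\<close>

lemma strongly_imp_weakly_effectively_coherent:
  assumes "strongly_effectively_coherent P"
  shows "weakly_effectively_coherent P"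
proof -
  obtain f where f: "partrec f" and out: "\<And>ws. set ws \<subseteq> words {..<fst P} \<Longrightarrow>
        (\<exists>Q \<phi>. f (encode_words ws) = Some (prod_encode (encode_pres Q, encode_words \<phi>)) \<and>
             valid_pres Q \<and> length \<phi> = fst Q \<and> set \<phi> \<subseteq> words {..<fst P} \<and>
             (\<exists>h \<in> mon (grp Q) (grp P).
               (\<forall>y < fst Q. h (elt Q [(y, True)]) = elt P (\<phi> ! y)) \<and>
               h ` carrier (grp Q) = carrier (sub_grp P ws)))"
    using assms unfolding strongly_effectively_coherent_def by blast
  show ?thesis
    unfolding weakly_effectively_coherent_def
  proof (intro conjI exI[of _ "\<lambda>n. Option.bind (f n) (\<lambda>n. Some (fst (prod_decode n)))"] allI impI)
    show "coherent (grp P)" using assms by (simp add: strongly_effectively_coherent_def)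
    show "partrec (\<lambda>n. Option.bind (f n) (\<lambda>n. Some (fst (prod_decode n))))"
      by (rule partrec.comp[OF partrec.fst f])
    fix ws assume ws: "set ws \<subseteq> words {..<fst P}"
    obtain Q \<phi> h where Q: "f (encode_words ws) = Some (prod_encode (encode_pres Q, encode_words \<phi>))"
      "valid_pres Q" and h: "h \<in> mon (grp Q) (grp P)" "h ` carrier (grp Q) = carrier (sub_grp P ws)"
      using out[OF ws] by (elim exE conjE bexE) (rule that; assumption)
    \<comment> \<open>The injection becomes an isomorphism once its target is restricted to its
      image.\<close>
    have "h x \<in> carrier (sub_grp P ws)" if "x \<in> carrier (grp Q)" for x
      using that h(2) by blast
    then have "h \<in> hom (grp Q) (sub_grp P ws)"
      using h(1) by (simp add: mon_def hom_def mult_sub_grp)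
    then have "h \<in> iso (grp Q) (sub_grp P ws)"
      using h by (simp add: mon_def iso_iff)
    then have "grp Q \<cong> sub_grp P ws" by (rule is_isoI)
    then show "\<exists>Q. Option.bind (f (encode_words ws)) (\<lambda>n. Some (fst (prod_decode n))) = Some (encode_pres Q)
        \<and> valid_pres Q \<and> grp Q \<cong> sub_grp P ws"
      using Q by (intro exI[of _ Q]) simp
  qed
qed

text \<open>The weak algorithm supplies \<open>Q\<close>, identification for the fixed
  \<open>P\<close> supplies generator images over \<open>ws\<close>, and substituting
  \<open>ws\<close> expresses these over the generators of \<open>P\<close>.\<close>

lemma weakly_imp_strongly_effectively_coherent:
  assumes "valid_pres P" "locally_hopfian (grp P)" "weakly_effectively_coherent P"
  shows "strongly_effectively_coherent P"
proof -
  obtain f where f: "partrec f" and f_out: "\<And>ws. set ws \<subseteq> words {..<fst P} \<Longrightarrow>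
        (\<exists>Q. f (encode_words ws) = Some (encode_pres Q) \<and> valid_pres Q \<and> grp Q \<cong> sub_grp P ws)"
    using assms(3) unfolding weakly_effectively_coherent_def by blast
  obtain g where g: "partrec g" and g_out: "\<And>ws Q. set ws \<subseteq> words {..<fst P} \<Longrightarrow> valid_pres Q \<Longrightarrow>
        sub_grp P ws \<cong> grp Q \<Longrightarrow>
        \<exists>\<phi>. g (prod_encode (encode_pres P, prod_encode (encode_words ws, encode_pres Q)))
               = Some (encode_words \<phi>) \<and> identifies_subgroup P ws Q \<phi>"
    using subgroup_identification_locally_hopfian assms(1,2)
    unfolding subgroup_identification_uniformly_solvable_def by meson
  have id: "partrec (\<lambda>n. Some n)"
    by (rule iffD1[OF computable_partrec computable_ident])
  have const: "partrec (\<lambda>_. Some (encode_pres P))"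
    by (rule iffD1[OF computable_partrec computable_const])
  \<comment> \<open>The total version is used because a realizer has to be correct also for words
    with indices out of range.\<close>
  have "computable (\<lambda>p. map (total_subst (fst p)) (snd p))"
    by (intro computable_intros)
  then obtain s where s: "partrec (\<lambda>n. Some (s n))"
    "\<And>ws \<phi>. s (prod_encode (encode ws, encode \<phi>)) = encode (map (total_subst ws) \<phi>)"
    by (auto simp: computable_def)
  \<comment> \<open>Here \<open>n\<close>, \<open>Q\<close> and \<open>\<phi>\<close> stand for
    codes.\<close>
  define F where "F = (\<lambda>n. Option.bind (f n) (\<lambda>Q.
    Option.bind (g (prod_encode (encode_pres P, prod_encode (n, Q))))
      (\<lambda>\<phi>. Some (prod_encode (Q, s (prod_encode (n, \<phi>)))))))"
  have "partrec (\<lambda>n. Option.bind (f n) (\<lambda>y. Some (prod_encode (n, y))))"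
    using partrec.pair[OF id f] by simp
  from partrec.pair[OF const this]
  have "partrec (\<lambda>n. Option.bind (f n) (\<lambda>y. Some (prod_encode (encode_pres P, prod_encode (n, y)))))"
    by (simp add: Option.bind_assoc)
  from partrec.comp[OF g this]
  have "partrec (\<lambda>n. Option.bind (f n) (\<lambda>y. g (prod_encode (encode_pres P, prod_encode (n, y)))))"
    by (simp add: Option.bind_assoc)
  from partrec.comp[OF s(1) partrec.pair[OF id this]]
  have "partrec (\<lambda>n. Option.bind (f n) (\<lambda>y. Option.bind (g (prod_encode (encode_pres P, prod_encode (n, y))))
      (\<lambda>\<phi>. Some (s (prod_encode (n, \<phi>))))))"
    by (simp add: Option.bind_assoc)
  \<comment> \<open>Pairing evaluates \<open>f\<close> twice on the same input; the two evaluations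
    agree, so the result is \<open>F\<close>.\<close>
  from partrec.pair[OF f this]
  have F: "partrec F"
    by (rule back_subst[of partrec])
      (auto simp: F_def fun_eq_iff Option.bind_assoc split: Option.bind_splits)
  show ?thesis
    unfolding strongly_effectively_coherent_def
  proof (intro conjI exI[of _ F] allI impI)
    show "coherent (grp P)" using assms(3) by (simp add: weakly_effectively_coherent_def)
    show "partrec F" by (rule F)
    fix ws assume ws: "set ws \<subseteq> words {..<fst P}"
    from f_out[OF this] obtain Q where Q: "f (encode_words ws) = Some (encode_pres Q)"
      "valid_pres Q" "grp Q \<cong> sub_grp P ws" by blast
    from g_out[OF ws Q(2) group.iso_sym[OF group_grp Q(3)]] obtain \<phi> where
      \<phi>: "g (prod_encode (encode_pres P, prod_encode (encode_words ws, encode_pres Q))) = Some (encode_words \<phi>)"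
      "identifies_subgroup P ws Q \<phi>" by blast
    then obtain h where len: "length \<phi> = fst Q" and \<phi>_words: "set \<phi> \<subseteq> words {..<length ws}"
      and h: "h \<in> iso (grp Q) (sub_grp P ws)"
        "\<And>y. y < fst Q \<Longrightarrow> h (elt Q [(y, True)]) = elt P (subst_word ws (\<phi> ! y))"
      by (auto simp: identifies_subgroup_def)
    let ?\<Phi> = "map (subst_word ws) \<phi>"
    have "map (total_subst ws) \<phi> = ?\<Phi>" using \<phi>_words by (auto simp: total_subst_eq)
    then have "F (encode_words ws) = Some (prod_encode (encode_pres Q, encode_words ?\<Phi>))"
      using Q(1) \<phi>(1) by (simp add: F_def encode_words_eq s(2))
    moreover have "set ?\<Phi> \<subseteq> words {..<fst P}" using \<phi>_words subst_word_words[OF ws] by auto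
    moreover have "h \<in> mon (grp Q) (grp P)"
      using h(1) carrier_sub_grp_subset[of P ws] by (auto simp: mon_def iso_iff hom_def mult_sub_grp)
    moreover have "h ` carrier (grp Q) = carrier (sub_grp P ws)" using h(1) by (simp add: iso_iff)
    ultimately show "\<exists>Q \<phi>. F (encode_words ws) = Some (prod_encode (encode_pres Q, encode_words \<phi>)) \<and>
             valid_pres Q \<and> length \<phi> = fst Q \<and> set \<phi> \<subseteq> words {..<fst P} \<and>
             (\<exists>h \<in> mon (grp Q) (grp P).
               (\<forall>y < fst Q. h (elt Q [(y, True)]) = elt P (\<phi> ! y)) \<and>
               h ` carrier (grp Q) = carrier (sub_grp P ws))"
      using Q(2) len h(2) by (intro exI[of _ Q] exI[of _ ?\<Phi>] conjI bexI[of _ h]) auto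
  qed
qed

theorem theorem3p8:
  shows "subgroup_identification_uniformly_solvable locally_hopfian \<and>
    (\<forall>P. valid_pres P \<and> locally_hopfian (grp P) \<longrightarrow>
      (weakly_effectively_coherent P \<longleftrightarrow> strongly_effectively_coherent P))"
  using subgroup_identification_locally_hopfian weakly_imp_strongly_effectively_coherent
    strongly_imp_weakly_effectively_coherent by blast

end
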